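(* Assume that $\operatorname{dom}Ef\cap(\mathcal X\times\mathcal U)\neq\emptyset$, i.e. $Ef(x,u)<\infty$ for some $(x,u)\in\mathcal X\times\mathcal U$. Let, for $(z,u)\in\mathcal X\times\mathcal U$, $$\varphi(z,u):=\inf_{x\in\mathcal X}\{Ef(x,u): x-z\in\mathcal N\},\qquad \bar\varphi(z,u):=\inf_{x\in L^0(\mathbb R^n)}\{Ef(x,u): x-z\in\mathcal N\}.$$ Then $\varphi^*=\bar\varphi^*$ on $\mathcal V\times\mathcal Y$.
   Context: $(\Omega,\mathcal F,P)$ is a probability space with a filtration $(\mathcal F_t)_{t=0}^T$ (an increasing sequence of sub-$\sigma$-algebras of $\mathcal F$). $n=n_0+\dots+n_T$ and $\mathcal N$ is the linear space of all $x=(x_t)_{t=0}^T\in L^0(\mathbb R^n)$ such that $x_t$ is $\mathbb R^{n_t}$-valued and $\mathcal F_t$-measurable for every $t$. Random variables equal a.s. are identified. Convention: the expectation of an extended real-valued random variable is $+\infty$ unless its positive part is integrable. $f$ is a convex normal integrand on $\mathbb R^n\times\mathbb R^m\times\Omega$: $f(\cdot,\omega)$ is a closed convex extended real-valued function for every $\omega$ (closed: lower semicontinuous and either proper or identically $+\infty$ or identically $-\infty$) and $\omega\mapsto\operatorname{epi}f(\cdot,\omega)$ is a measurable set-valued mapping. $Ef(x,u):=\int f(x(\omega),u(\omega),\omega)\,dP(\omega)$. A linear space $\mathcal U$ of $\mathbb R^m$-valued random variables is decomposable if $1_Au+1_{\Omega\setminus A}u'\in\mathcal U$ for all $u\in\mathcal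 U$, $u'\in L^\infty$, $A\in\mathcal F$; it is solid if $\bar u\in\mathcal U$, $u\in L^0$ and $|u^i|\le|\bar u^i|$ a.s. for all components $i$ imply $u\in\mathcal U$. $\mathcal X,\mathcal V$ are solid decomposable spaces of $\mathbb R^n$-valued random variables in separating duality under $\langle x,v\rangle:=E[x\cdot v]$ and $\mathcal U,\mathcal Y$ are solid decomposable spaces of $\mathbb R^m$-valued random variables in separating duality under $\langle u,y\rangle:=E[u\cdot y]$ (in particular the products are integrable). For $g:\mathcal X\times\mathcal U\to[-\infty,\infty]$, $g^*(p,y):=\sup_{(z,u)\in\mathcal X\times\mathcal U}\{\langle z,p\rangle+\langle u,y\rangle-g(z,u)\}$ for $(p,y)\in\mathcal V\times\mathcal Y$. *)

theory Defs
  imports "HOL-Probability.Probability"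
begin

section \<open>Convex normal integrands\<close>

definition epi :: "('a \<Rightarrow> ereal) \<Rightarrow> ('a \<times> real) set" where
  "epi g = {(x, \<alpha>). g x \<le> ereal \<alpha>}"

definition lsc :: "('a::topological_space \<Rightarrow> ereal) \<Rightarrow> bool" where
  "lsc g \<longleftrightarrow> (\<forall>x. g x \<le> Liminf (at x) g)"

definition proper_fun :: "('a \<Rightarrow> ereal) \<Rightarrow> bool" where
  "proper_fun g \<longleftrightarrow> (\<forall>x. g x \<noteq> -\<infinity>) \<and> (\<exists>x. g x \<noteq> \<infinity>)"

definition closed_fun :: "('a::topological_space \<Rightarrow> ereal) \<Rightarrow> bool" where
  "closed_fun g \<longleftrightarrow>
     lsc g \<and> (proper_fun g \<or> (\<forall>x. g x = \<infinity>) \<or> (\<forall>x. g x = -\<infinity>))"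

definition convex_fun :: "('a::real_vector \<Rightarrow> ereal) \<Rightarrow> bool" where
  "convex_fun g \<longleftrightarrow> convex (epi g)"

definition measurable_set_mapping ::
    "'w measure \<Rightarrow> ('w \<Rightarrow> ('b::topological_space) set) \<Rightarrow> bool" where
  "measurable_set_mapping M S \<longleftrightarrow>
     (\<forall>G. open G \<longrightarrow> {\<omega> \<in> space M. S \<omega> \<inter> G \<noteq> {}} \<in> sets M)"

definition convex_normal_integrand ::
    "'w measure \<Rightarrow> ('a::euclidean_space \<Rightarrow> 'w \<Rightarrow> ereal) \<Rightarrow> bool" where
  "convex_normal_integrand M f \<longleftrightarrow>
     (\<forall>\<omega>\<in>space M. closed_fun (\<lambda>x. f x \<omega>) \<and> convex_fun (\<lambda>x. f x \<omega>)) \<and>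
     measurable_set_mapping M (\<lambda>\<omega>. epi (\<lambda>x. f x \<omega>))"

section \<open>Expectations of extended real-valued random variables\<close>

text \<open>
  The function \<^const>\<open>e2ennreal\<close> sends negative numbers to \<open>0\<close>, so the two integrals below are those
  of the positive and the negative part. The expectation is \<open>\<infinity>\<close> unless the positive part is
  integrable.
\<close>
definition ext_expectation :: "'w measure \<Rightarrow> ('w \<Rightarrow> ereal) \<Rightarrow> ereal" where
  "ext_expectation M \<xi> =
     (if (\<integral>\<^sup>+ \<omega>. e2ennreal (\<xi> \<omega>) \<partial>M) < \<infinity>
      then enn2ereal (\<integral>\<^sup>+ \<omega>. e2ennreal (\<xi> \<omega>) \<partial>M) - enn2ereal (\<integral>\<^sup>+ \<omega>. e2ennreal (- \<xi> \<omega>) \<partial>M)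
      else \<infinity>)"

definition integral_functional ::
    "'w measure \<Rightarrow> ('a \<times> 'b \<Rightarrow> 'w \<Rightarrow> ereal) \<Rightarrow> ('w \<Rightarrow> 'a) \<Rightarrow> ('w \<Rightarrow> 'b) \<Rightarrow> ereal" where
  "integral_functional M f x u = ext_expectation M (\<lambda>\<omega>. f (x \<omega>, u \<omega>) \<omega>)"

section \<open>Spaces of random variables\<close>

text \<open>
  Random variables are represented by functions. Spaces of random variables are sets of functions;
  the solid ones and \<open>nonanticipative\<close> below are closed under almost sure equality.
\<close>
definition rv_linear_space ::
    "'w measure \<Rightarrow> ('w \<Rightarrow> 'a::euclidean_space) set \<Rightarrow> bool" where
  "rv_linear_space M U \<longleftrightarrow>
     U \<subseteq> borel_measurable M \<and>
     (\<lambda>_. 0) \<in> U \<and>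
     (\<forall>u\<in>U. \<forall>v\<in>U. (\<lambda>\<omega>. u \<omega> + v \<omega>) \<in> U) \<and>
     (\<forall>c. \<forall>u\<in>U. (\<lambda>\<omega>. c *\<^sub>R u \<omega>) \<in> U)"

definition L_infty :: "'w measure \<Rightarrow> ('w \<Rightarrow> 'a::euclidean_space) set" where
  "L_infty M = {u \<in> borel_measurable M. \<exists>C. AE \<omega> in M. norm (u \<omega>) \<le> C}"

definition decomposable ::
    "'w measure \<Rightarrow> ('w \<Rightarrow> 'a::euclidean_space) set \<Rightarrow> bool" where
  "decomposable M U \<longleftrightarrow>
     (\<forall>u\<in>U. \<forall>u'\<in>L_infty M. \<forall>A\<in>sets M.
        (\<lambda>\<omega>. indicator A \<omega> *\<^sub>R u \<omega> + indicator (space M - A) \<omega> *\<^sub>R u' \<omega>) \<in> U)"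

definition solid :: "'w measure \<Rightarrow> ('w \<Rightarrow> real ^ 'k) set \<Rightarrow> bool" where
  "solid M U \<longleftrightarrow>
     (\<forall>v\<in>U. \<forall>u\<in>borel_measurable M.
        (\<forall>i. AE \<omega> in M. \<bar>u \<omega> $ i\<bar> \<le> \<bar>v \<omega> $ i\<bar>) \<longrightarrow> u \<in> U)"

definition solid_decomposable_space :: "'w measure \<Rightarrow> ('w \<Rightarrow> real ^ 'k) set \<Rightarrow> bool" where
  "solid_decomposable_space M U \<longleftrightarrow> rv_linear_space M U \<and> decomposable M U \<and> solid M U"

definition pairing ::
    "'w measure \<Rightarrow> ('w \<Rightarrow> 'a::euclidean_space) \<Rightarrow> ('w \<Rightarrow> 'a) \<Rightarrow> real" where
  "pairing M u y = (\<integral>\<omega>. u \<omega> \<bullet> y \<omega> \<partial>M)"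

definition separating_duality ::
    "'w measure \<Rightarrow> ('w \<Rightarrow> 'a::euclidean_space) set \<Rightarrow> ('w \<Rightarrow> 'a) set \<Rightarrow> bool" where
  "separating_duality M U Y \<longleftrightarrow>
     (\<forall>u\<in>U. \<forall>y\<in>Y. integrable M (\<lambda>\<omega>. u \<omega> \<bullet> y \<omega>)) \<and>
     (\<forall>u\<in>U. (\<forall>y\<in>Y. pairing M u y = 0) \<longrightarrow> (AE \<omega> in M. u \<omega> = 0)) \<and>
     (\<forall>y\<in>Y. (\<forall>u\<in>U. pairing M u y = 0) \<longrightarrow> (AE \<omega> in M. y \<omega> = 0))"

section \<open>Nonanticipative strategies\<close>

definition finite_filtration :: "'w measure \<Rightarrow> nat \<Rightarrow> (nat \<Rightarrow> 'w measure) \<Rightarrow> bool" where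
  "finite_filtration M T F \<longleftrightarrow>
     (\<forall>t\<le>T. subalgebra M (F t)) \<and> (\<forall>t\<le>T. \<forall>s\<le>t. subalgebra (F t) (F s))"

text \<open>
  The splitting \<open>x = (x\<^sub>0, \<dots>, x\<^sub>T)\<close> of a vector into blocks is given by a map \<open>stage\<close> from coordinates
  to \<open>{0..T}\<close>: the block \<open>x\<^sub>t\<close> consists of the coordinates \<open>i\<close> with \<open>stage i = t\<close>, so that its
  dimension \<open>n\<^sub>t\<close> is the number of these (possibly zero) and \<open>n = n\<^sub>0 + \<dots> + n\<^sub>T\<close>.
\<close>
definition adapted ::
    "nat \<Rightarrow> (nat \<Rightarrow> 'w measure) \<Rightarrow> ('n \<Rightarrow> nat) \<Rightarrow> ('w \<Rightarrow> real ^ 'n) \<Rightarrow> bool" where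
  "adapted T F stage x \<longleftrightarrow>
     (\<forall>t\<le>T. \<forall>i. stage i = t \<longrightarrow> (\<lambda>\<omega>. x \<omega> $ i) \<in> borel_measurable (F t))"

text \<open>
  The \<open>\<sigma>\<close>-algebras need not contain the null sets, so adaptedness of an equivalence class means
  that some representative is adapted.
\<close>
definition nonanticipative ::
    "'w measure \<Rightarrow> nat \<Rightarrow> (nat \<Rightarrow> 'w measure) \<Rightarrow> ('n \<Rightarrow> nat) \<Rightarrow> ('w \<Rightarrow> real ^ 'n) set" where
  "nonanticipative M T F stage =
     {x \<in> borel_measurable M. \<exists>x'. adapted T F stage x' \<and> (AE \<omega> in M. x \<omega> = x' \<omega>)}"

section \<open>Value functions and conjugates\<close>

text \<open>
  The set \<open>D\<close> of admissible \<open>x\<close> is the space \<open>\<X>\<close> for the value function \<open>\<phi>\<close> and the space of all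
  random variables for its extension.
\<close>
definition value_function ::
    "'w measure \<Rightarrow> ((real ^ 'n) \<times> (real ^ 'm) \<Rightarrow> 'w \<Rightarrow> ereal) \<Rightarrow> ('w \<Rightarrow> real ^ 'n) set \<Rightarrow>
     ('w \<Rightarrow> real ^ 'n) set \<Rightarrow> ('w \<Rightarrow> real ^ 'n) \<Rightarrow> ('w \<Rightarrow> real ^ 'm) \<Rightarrow> ereal" where
  "value_function M f N D z u =
     (INF x\<in>{x \<in> D. (\<lambda>\<omega>. x \<omega> - z \<omega>) \<in> N}. integral_functional M f x u)"

definition conjugate ::
    "'w measure \<Rightarrow> ('w \<Rightarrow> 'a::euclidean_space) set \<Rightarrow> ('w \<Rightarrow> 'b::euclidean_space) set \<Rightarrow>
     (('w \<Rightarrow> 'a) \<Rightarrow> ('w \<Rightarrow> 'b) \<Rightarrow> ereal) \<Rightarrow> ('w \<Rightarrow> 'a) \<Rightarrow> ('w \<Rightarrow> 'b) \<Rightarrow> ereal" where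
  "conjugate M X U g p y =
     (SUP (z, u)\<in>X \<times> U. ereal (pairing M z p + pairing M u y) - g z u)"

end

theory Submission
  imports Defs
begin

text \<open>
  Since \<open>\<X>\<close> is contained in \<open>L\<^sup>0\<close>, only the inequality between \<open>\<phi>bar\<^sup>*(p, y)\<close> and \<open>c = \<phi>\<^sup>*(p, y)\<close> needs an
  argument, and only for finite \<open>c\<close>. Perturbing a feasible point of the primal space along
  \<open>\<N> \<inter> \<X>\<close> shows that \<open>p\<close> is orthogonal to \<open>\<N> \<inter> \<X>\<close>. A strategy \<open>x\<close> in \<open>L\<^sup>0\<close> with \<open>x - z \<in> \<N>\<close> is approximated
  by pasting it with the feasible point outside of \<open>{\<bar>x - z\<bar> \<le> k}\<close>; the bound \<open>c\<close> on the pasted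
  strategies makes the positive part of \<open>(x - z) \<bullet> p\<close> integrable, and as in the theory of local
  martingales this one-sided bound and orthogonality imply that \<open>(x - z) \<bullet> p\<close> is integrable with
  mean zero. Expectations of normal integrands are replaced throughout by integrals of integrable
  real majorants, which avoids infinite values.
\<close>


section \<open>Measurability of normal integrands\<close>

text \<open>Every level below \<open>g x\<close> is eventually exceeded by \<open>g\<close> along
  the sequence, hence by the heights \<open>\<alpha>\<close> of the points, and so is at most their
  limit.\<close>

lemma closed_epi:
  fixes g :: "'a::euclidean_space \<Rightarrow> ereal"
  assumes "lsc g"
  shows "closed (epi g)"
  unfolding closed_sequential_limits
proof (intro allI impI, elim conjE)
  fix s :: "nat \<Rightarrow> 'a \<times> real" and l
  assume s: "\<forall>n. s n \<in> epi g" and l: "s \<longlonglongrightarrow> l"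
  obtain x \<alpha> where lx: "l = (x, \<alpha>)" by (cases l)
  have x: "(\<lambda>n. fst (s n)) \<longlonglongrightarrow> x" and \<alpha>: "(\<lambda>n. snd (s n)) \<longlonglongrightarrow> \<alpha>"
    using tendsto_fst[OF l] tendsto_snd[OF l] lx by auto
  have le: "g (fst (s n)) \<le> ereal (snd (s n))" for n
    using s[rule_format, of n] by (auto simp: epi_def split: prod.splits)
  have "g x \<le> ereal \<alpha>"
  proof (rule dense_le)
    fix y assume "y < g x"
    then have "y < Liminf (at x) g" using assms by (auto simp: lsc_def intro: less_le_trans)
    then have "\<forall>\<^sub>F v in at x. y < g v" by (rule less_LiminfD)
    \<comment> \<open>\<open>lsc\<close> is stated with punctured neighbourhoods, while the sequence
      may hit \<open>x\<close> itself; there the inequality is \<open>y < g x\<close>.\<close>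
    then have "\<forall>\<^sub>F v in nhds x. v \<noteq> x \<longrightarrow> y < g v" by (simp add: eventually_at_filter)
    then have "\<forall>\<^sub>F v in nhds x. y < g v" 
      by eventually_elim (use \<open>y < g x\<close> in auto)
    with x have "\<forall>\<^sub>F n in sequentially. y < g (fst (s n))"
      unfolding filterlim_iff by blast
    then have "\<forall>\<^sub>F n in sequentially. y \<le> ereal (snd (s n))"
      by eventually_elim (use le in \<open>meson less_imp_le less_le_trans\<close>)
    moreover have "(\<lambda>n. ereal (snd (s n))) \<longlonglongrightarrow> ereal \<alpha>" using \<alpha> by simp
    ultimately show "y \<le> ereal \<alpha>" by (intro tendsto_lowerbound) auto
  qed
  then show "l \<in> epi g" by (simp add: lx epi_def)
qed


text \<open>The hypothesis tells when the epigraph meets an open set, whereas a sublevel set asks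
  whether it contains \<open>(x \<omega>, \<alpha>)\<close>. Closedness and a countable base
  translate the second question into countably many instances of the first.\<close>

lemma borel_measurable_normal_integrand:
  fixes f :: "'a::euclidean_space \<Rightarrow> 'w \<Rightarrow> ereal"
  assumes f: "convex_normal_integrand M f" and x[measurable]: "x \<in> borel_measurable M"
  shows "(\<lambda>\<omega>. f (x \<omega>) \<omega>) \<in> borel_measurable M"
proof -
  obtain B :: "('a \<times> real) set set" where B: "countable B" "topological_basis B"
    using ex_countable_basis by blast
  have sublevel: "{\<omega> \<in> space M. f (x \<omega>) \<omega> \<le> ereal \<alpha>} \<in> sets M" for \<alpha>
  proof -
    \<comment> \<open>A point lies in a closed set iff all its neighbourhoods from a countable base meet the set.\<close>
    have "f (x \<omega>) \<omega> \<le> ereal \<alpha> \<longleftrightarrow>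
        (\<forall>G\<in>B. (x \<omega>, \<alpha>) \<in> G \<longrightarrow> epi (\<lambda>x. f x \<omega>) \<inter> G \<noteq> {})" if "\<omega> \<in> space M" for \<omega>
    proof -
      let ?S = "epi (\<lambda>x. f x \<omega>)"
      have cl: "closed ?S"
        using f that by (intro closed_epi) (auto simp: convex_normal_integrand_def closed_fun_def)
      have "f (x \<omega>) \<omega> \<le> ereal \<alpha> \<longleftrightarrow> (x \<omega>, \<alpha>) \<in> ?S" by (simp add: epi_def)
      also have "\<dots> \<longleftrightarrow> (\<forall>G\<in>B. (x \<omega>, \<alpha>) \<in> G \<longrightarrow> ?S \<inter> G \<noteq> {})"
      proof
        assume *: "\<forall>G\<in>B. (x \<omega>, \<alpha>) \<in> G \<longrightarrow> ?S \<inter> G \<noteq> {}"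
        show "(x \<omega>, \<alpha>) \<in> ?S"
        proof (rule ccontr)
          assume "(x \<omega>, \<alpha>) \<notin> ?S"
          then obtain G where "G \<in> B" "(x \<omega>, \<alpha>) \<in> G" "G \<subseteq> - ?S"
            using topological_basisE[OF B(2), of "- ?S" "(x \<omega>, \<alpha>)"] cl by (auto simp: open_Compl)
          with * show False by blast
        qed
      qed auto
      finally show ?thesis .
    qed
    then have "{\<omega> \<in> space M. f (x \<omega>) \<omega> \<le> ereal \<alpha>} =
      {\<omega> \<in> space M. \<forall>G\<in>B. (x \<omega>, \<alpha>) \<in> G \<longrightarrow> \<omega> \<in> {\<omega> \<in> space M. epi (\<lambda>x. f x \<omega>) \<inter> G \<noteq> {}}}"
      by blast
    also have "\<dots> \<in> sets M"
    proof (rule sets.sets_Collect_countable_All'[OF _ B(1)])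
      fix G assume "G \<in> B"
      then have G: "open G" using topological_basis_open B(2) by blast
      have [measurable]: "{\<omega> \<in> space M. epi (\<lambda>x. f x \<omega>) \<inter> G \<noteq> {}} \<in> sets M"
        using f G by (auto simp: convex_normal_integrand_def measurable_set_mapping_def)
      have [measurable]: "G \<in> sets borel" using G by simp
      have [measurable]: "(\<lambda>\<omega>. (x \<omega>, \<alpha>)) \<in> M \<rightarrow>\<^sub>M borel"
        by (intro borel_measurable_Pair) auto
      show "{\<omega> \<in> space M. (x \<omega>, \<alpha>) \<in> G \<longrightarrow> \<omega> \<in> {\<omega> \<in> space M. epi (\<lambda>x. f x \<omega>) \<inter> G \<noteq> {}}} \<in> sets M"
        by measurable
    qed
    finally show ?thesis .
  qed
  show ?thesis
  proof (rule borel_measurableI_le)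
    fix y :: ereal
    show "{\<omega> \<in> space M. f (x \<omega>) \<omega> \<le> y} \<in> sets M"
    proof (cases y)
      case (real \<alpha>)
      then show ?thesis using sublevel by simp
    next
      case PInf
      then show ?thesis by simp
    next
      case MInf
      \<comment> \<open>The level \<open>-\<infinity>\<close> is reached as the intersection over
        the real levels \<open>- real n\<close>.\<close>
      have "{\<omega> \<in> space M. f (x \<omega>) \<omega> \<le> y} = {\<omega> \<in> space M. \<forall>n::nat. f (x \<omega>) \<omega> \<le> ereal (- real n)}"
      proof (intro Collect_cong conj_cong refl iffI allI)
        fix \<omega> assume *: "\<forall>n::nat. f (x \<omega>) \<omega> \<le> ereal (- real n)"
        have "f (x \<omega>) \<omega> \<le> ereal z" for z
        proof -
          obtain n :: nat where "- z \<le> real n" using real_arch_simple by blast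
          then show ?thesis using *[rule_format, of n] by (metis ereal_less_eq(3) minus_le_iff order_trans)
        qed
        then have "f (x \<omega>) \<omega> = - \<infinity>" by (rule ereal_bot)
        then show "f (x \<omega>) \<omega> \<le> y" by simp
      qed (use MInf in auto)
      also have "\<dots> \<in> sets M" by (intro sets.sets_Collect_countable_All) (rule sublevel)
      finally show ?thesis .
    qed
  qed
qed

section \<open>Extended expectations\<close>

text \<open>The majorant enlarges the positive part and shrinks the negative one. So the positive
  part of \<open>\<xi>\<close> is integrable and the default \<open>\<infinity>\<close> does not
  arise; both integrals of \<open>r\<close> being finite, their difference is the real
  integral.\<close>

lemma ext_expectation_le_integral:
  assumes r: "integrable M r" and le: "AE \<omega> in M. \<xi> \<omega> \<le> ereal (r \<omega>)"
  shows "ext_expectation M \<xi> \<le> ereal (\<integral>\<omega>. r \<omega> \<partial>M)"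
proof -
  have fin: "(\<integral>\<^sup>+ \<omega>. ennreal (r \<omega>) \<partial>M) \<noteq> \<infinity>" "(\<integral>\<^sup>+ \<omega>. ennreal (- r \<omega>) \<partial>M) \<noteq> \<infinity>"
    using r unfolding real_integrable_def by auto
  have P: "(\<integral>\<^sup>+ \<omega>. e2ennreal (\<xi> \<omega>) \<partial>M) \<le> (\<integral>\<^sup>+ \<omega>. ennreal (r \<omega>) \<partial>M)"
    using le by (intro nn_integral_mono_AE) (auto simp flip: e2ennreal_ereal intro: e2ennreal_mono)
  have N: "(\<integral>\<^sup>+ \<omega>. ennreal (- r \<omega>) \<partial>M) \<le> (\<integral>\<^sup>+ \<omega>. e2ennreal (- \<xi> \<omega>) \<partial>M)"
    using le
  proof (intro nn_integral_mono_AE, eventually_elim)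
    fix \<omega> assume "\<xi> \<omega> \<le> ereal (r \<omega>)"
    then have "ereal (- r \<omega>) \<le> - \<xi> \<omega>"
      by (metis ereal_minus_le_minus uminus_ereal.simps(1))
    then show "ennreal (- r \<omega>) \<le> e2ennreal (- \<xi> \<omega>)"
      by (metis e2ennreal_ereal e2ennreal_mono)
  qed
  have "ext_expectation M \<xi> =
      enn2ereal (\<integral>\<^sup>+ \<omega>. e2ennreal (\<xi> \<omega>) \<partial>M) - enn2ereal (\<integral>\<^sup>+ \<omega>. e2ennreal (- \<xi> \<omega>) \<partial>M)"
    using P fin(1) by (auto simp: ext_expectation_def top.not_eq_extremum intro: le_less_trans)
  also have "\<dots> \<le> enn2ereal (\<integral>\<^sup>+ \<omega>. ennreal (r \<omega>) \<partial>M) - enn2ereal (\<integral>\<^sup>+ \<omega>. ennreal (- r \<omega>) \<partial>M)"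
    using P N by (intro ereal_minus_mono) (auto simp: less_eq_ennreal.rep_eq)
  also have "\<dots> = ereal (\<integral>\<omega>. r \<omega> \<partial>M)"
    using fin by (subst real_lebesgue_integral_def[OF r])
      (cases "\<integral>\<^sup>+ \<omega>. ennreal (r \<omega>) \<partial>M"; cases "\<integral>\<^sup>+ \<omega>. ennreal (- r \<omega>) \<partial>M"; simp)
  finally show ?thesis .
qed

text \<open>Cutting \<open>\<xi>\<close> off below at \<open>- k\<close> gives an integrable
  function, as the measure is finite, and by monotone convergence its integral drops below
  \<open>a\<close> for large \<open>k\<close>. This covers the expectation
  \<open>-\<infinity>\<close> as well.\<close>

lemma (in finite_measure) ext_expectation_less_obtain_majorant:
  assumes [measurable]: "\<xi> \<in> borel_measurable M" and less: "ext_expectation M \<xi> < ereal a"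
  obtains r where "integrable M r" "AE \<omega> in M. \<xi> \<omega> \<le> ereal (r \<omega>)" "(\<integral>\<omega>. r \<omega> \<partial>M) < a"
proof -
  define P where "P = (\<integral>\<^sup>+ \<omega>. e2ennreal (\<xi> \<omega>) \<partial>M)"
  define Q where "Q = (\<integral>\<^sup>+ \<omega>. e2ennreal (- \<xi> \<omega>) \<partial>M)"
  define Qk where "Qk k = (\<integral>\<^sup>+ \<omega>. min (e2ennreal (- \<xi> \<omega>)) (of_nat k) \<partial>M)" for k :: nat
  have P: "P < \<infinity>" and PQ: "enn2ereal P - enn2ereal Q < ereal a"
    using less by (auto simp: ext_expectation_def P_def Q_def split: if_splits)
  then obtain b where b: "P = ennreal b" "b \<ge> 0" by (cases P) auto
  have Q_SUP: "Q = (SUP k. Qk k)"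
  proof -
    have "(SUP k::nat. min c (of_nat k)) = c" for c :: ennreal
      by (simp add: ennreal_SUP_of_nat_eq_top inf_min[symmetric] inf_SUP[symmetric])
    then have "Q = (\<integral>\<^sup>+ \<omega>. (SUP k::nat. min (e2ennreal (- \<xi> \<omega>)) (of_nat k)) \<partial>M)"
      unfolding Q_def by simp
    also have "\<dots> = (SUP k. Qk k)" unfolding Qk_def
      by (intro nn_integral_monotone_convergence_SUP)
        (auto simp: incseq_def le_fun_def intro: min.coboundedI2)
    finally show ?thesis .
  qed
  \<comment> \<open>The cut-off function will have integral \<open>b\<close> minus
    \<open>Qk k\<close>, which must be below \<open>a\<close>. Negative \<open>b - a\<close> is
    treated apart because \<open>ennreal\<close> would clip it to 0.\<close>
  have "\<exists>k. ereal (b - a) < enn2ereal (Qk k)"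
  proof (cases "b - a < 0")
    case True
    then show ?thesis using enn2ereal_nonneg[of "Qk 0"]
      by (intro exI[of _ 0]) (metis less_le_trans zero_ereal_def less_ereal.simps(1))
  next
    case False
    have "ereal (b - a) < enn2ereal Q"
      using PQ b by (cases Q) (auto simp: ereal_minus_less)
    then have "ennreal (b - a) < Q" using False by (simp add: less_ennreal.rep_eq)
    then obtain k where "ennreal (b - a) < Qk k" unfolding Q_SUP less_SUP_iff by blast
    then show ?thesis using False by (intro exI[of _ k]) (simp add: less_ennreal.rep_eq)
  qed
  then obtain k where k: "ereal (b - a) < enn2ereal (Qk k)" by blast
  \<comment> \<open>\<open>real_of_ereal\<close> sends \<open>\<infinity>\<close> to 0, but
    \<open>\<xi>\<close> avoids \<open>\<infinity>\<close> almost everywhere because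
    \<open>P\<close> is finite; the maximum removes \<open>-\<infinity>\<close>.\<close>
  define r where "r \<omega> = real_of_ereal (max (\<xi> \<omega>) (ereal (- real k)))" for \<omega>
  have [measurable]: "r \<in> borel_measurable M" unfolding r_def by measurable
  have "AE \<omega> in M. e2ennreal (\<xi> \<omega>) \<noteq> \<infinity>"
    using P unfolding P_def by (intro nn_integral_PInf_AE) auto
  then have fin: "AE \<omega> in M. \<xi> \<omega> \<noteq> \<infinity>" by eventually_elim auto
  have pos: "(\<integral>\<^sup>+ \<omega>. ennreal (r \<omega>) \<partial>M) = P" unfolding P_def
    using fin
  proof (intro nn_integral_cong_AE, eventually_elim)
    fix \<omega> assume "\<xi> \<omega> \<noteq> \<infinity>"
    then show "ennreal (r \<omega>) = e2ennreal (\<xi> \<omega>)"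
      by (cases "\<xi> \<omega>") (auto simp: r_def max_def ennreal_neg e2ennreal_neg)
  qed
  have neg: "(\<integral>\<^sup>+ \<omega>. ennreal (- r \<omega>) \<partial>M) = Qk k" unfolding Qk_def
    using fin
  proof (intro nn_integral_cong_AE, eventually_elim)
    fix \<omega> assume "\<xi> \<omega> \<noteq> \<infinity>"
    then show "ennreal (- r \<omega>) = min (e2ennreal (- \<xi> \<omega>)) (of_nat k)"
      by (cases "\<xi> \<omega>") (auto simp: r_def max_def min_def ennreal_of_nat_eq_real_of_nat top_unique)
  qed
  have "Qk k \<le> (\<integral>\<^sup>+ \<omega>. of_nat k \<partial>M)" unfolding Qk_def by (intro nn_integral_mono) auto
  also have "\<dots> < \<infinity>" 
    by (simp add: emeasure_eq_measure ennreal_of_nat_eq_real_of_nat ennreal_mult[symmetric])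
  finally have Qk: "Qk k < \<infinity>" .
  show thesis
  proof
    show int: "integrable M r"
      unfolding real_integrable_def using pos neg P Qk by auto
    show "AE \<omega> in M. \<xi> \<omega> \<le> ereal (r \<omega>)"
      using fin
    proof eventually_elim
      fix \<omega> assume "\<xi> \<omega> \<noteq> \<infinity>"
      then show "\<xi> \<omega> \<le> ereal (r \<omega>)" by (cases "\<xi> \<omega>") (auto simp: r_def max_def)
    qed
    obtain q where q: "Qk k = ennreal q" "q \<ge> 0" using Qk by (cases "Qk k") auto
    show "(\<integral>\<omega>. r \<omega> \<partial>M) < a"
      unfolding real_lebesgue_integral_def[OF int] pos neg using k b q by simp
  qed
qed


section \<open>Truncation\<close>

lemma integrable_truncation:
  fixes g a :: "'w \<Rightarrow> real"
  assumes "integrable M g" and [measurable]: "a \<in> borel_measurable M"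
  shows "integrable M (\<lambda>\<omega>. if \<bar>a \<omega>\<bar> \<le> c then g \<omega> else 0)"
  using assms(1) borel_measurable_integrable[OF assms(1)]
  by (rule_tac Bochner_Integration.integrable_bound) auto

text \<open>\<open>\<bar>g\<bar>\<close> dominates, and at each point the truncation is inactive
  once \<open>k\<close> exceeds the real number \<open>\<bar>a \<omega>\<bar>\<close>.\<close>

lemma integral_truncation_tendsto:
  fixes g a :: "'w \<Rightarrow> real"
  assumes g: "integrable M g" and [measurable]: "a \<in> borel_measurable M"
  shows "(\<lambda>k. \<integral>\<omega>. (if \<bar>a \<omega>\<bar> \<le> real k then g \<omega> else 0) \<partial>M) \<longlonglongrightarrow> (\<integral>\<omega>. g \<omega> \<partial>M)"
proof (rule integral_dominated_convergence[where w="\<lambda>\<omega>. \<bar>g \<omega>\<bar>"])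
  have [measurable]: "g \<in> borel_measurable M" using g by auto
  show "g \<in> borel_measurable M"
    "(\<lambda>\<omega>. if \<bar>a \<omega>\<bar> \<le> real k then g \<omega> else 0) \<in> borel_measurable M" for k
    by measurable
  show "AE \<omega> in M. (\<lambda>k. if \<bar>a \<omega>\<bar> \<le> real k then g \<omega> else 0) \<longlonglongrightarrow> g \<omega>"
  proof (intro AE_I2 tendsto_eventually)
    fix \<omega>
    show "\<forall>\<^sub>F k in sequentially. (if \<bar>a \<omega>\<bar> \<le> real k then g \<omega> else 0) = g \<omega>"
      using eventually_ge_at_top[of "nat \<lceil>\<bar>a \<omega>\<bar>\<rceil>"]
      by eventually_elim (auto simp: nat_le_iff ceiling_le_iff)
  qed
qed (use g in auto)

text \<open>Monotone convergence: the truncations increase to \<open>g\<close>, and their bounded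
  integrals converge.\<close>

lemma integrable_of_bounded_truncations:
  fixes g a :: "'w \<Rightarrow> real"
  assumes [measurable]: "a \<in> borel_measurable M" "g \<in> borel_measurable M"
    and nonneg: "\<And>\<omega>. 0 \<le> g \<omega>"
    and int: "\<And>k::nat. integrable M (\<lambda>\<omega>. if \<bar>a \<omega>\<bar> \<le> real k then g \<omega> else 0)"
    and bound: "\<And>k::nat. (\<integral>\<omega>. (if \<bar>a \<omega>\<bar> \<le> real k then g \<omega> else 0) \<partial>M) \<le> d"
  shows "integrable M g"
proof -
  let ?g = "\<lambda>k \<omega>. if \<bar>a \<omega>\<bar> \<le> real k then g \<omega> else 0"
  have mono: "mono (\<lambda>k. ?g k \<omega>)" for \<omega>
    using nonneg[of \<omega>] by (auto simp: mono_def)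
  have "incseq (\<lambda>k. \<integral>\<omega>. ?g k \<omega> \<partial>M)"
    using int nonneg by (intro monoI integral_mono) auto
  then obtain L where L: "(\<lambda>k. \<integral>\<omega>. ?g k \<omega> \<partial>M) \<longlonglongrightarrow> L"
    using incseq_convergent bound by blast
  show ?thesis
  proof (rule integrable_monotone_convergence[OF int _ _ L])
    show "AE \<omega> in M. mono (\<lambda>k. ?g k \<omega>)" using mono by simp
    show "AE \<omega> in M. (\<lambda>k. ?g k \<omega>) \<longlonglongrightarrow> g \<omega>"
    proof (intro AE_I2 tendsto_eventually)
      fix \<omega>
      show "\<forall>\<^sub>F k in sequentially. ?g k \<omega> = g \<omega>"
        using eventually_ge_at_top[of "nat \<lceil>\<bar>a \<omega>\<bar>\<rceil>"]
        by eventually_elim (auto simp: nat_le_iff ceiling_le_iff)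
    qed
  qed simp
qed

section \<open>Adapted integrands against a dual process orthogonal to them\<close>

text \<open>
  The single products \<open>w i * p i\<close> need not be integrable. Truncating on the size of a coordinate
  of the smallest stage keeps all other coordinates adapted, and makes the product of that
  coordinate integrable with mean zero, so that it can be split off.
\<close>
lemma integral_adapted_sum_eq_0:
  fixes p w :: "'i \<Rightarrow> 'w \<Rightarrow> real" and s :: "'i \<Rightarrow> nat"
  assumes "finite I"
    and sub: "\<And>i. i \<in> I \<Longrightarrow> subalgebra M (F (s i))"
    and filt: "\<And>i j. i \<in> I \<Longrightarrow> j \<in> I \<Longrightarrow> s i \<le> s j \<Longrightarrow> subalgebra (F (s j)) (F (s i))"
    and p: "\<And>i. i \<in> I \<Longrightarrow> integrable M (p i)"
    and orth: "\<And>i v C. i \<in> I \<Longrightarrow> v \<in> borel_measurable (F (s i)) \<Longrightarrow> (\<And>\<omega>. \<bar>v \<omega>\<bar> \<le> C) \<Longrightarrow>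
      (\<integral>\<omega>. v \<omega> * p i \<omega> \<partial>M) = 0"
    and w: "\<And>i. i \<in> I \<Longrightarrow> w i \<in> borel_measurable (F (s i))"
    and pos: "integrable M (\<lambda>\<omega>. max 0 (\<Sum>i\<in>I. w i \<omega> * p i \<omega>))"
  shows "integrable M (\<lambda>\<omega>. \<Sum>i\<in>I. w i \<omega> * p i \<omega>) \<and> (\<integral>\<omega>. (\<Sum>i\<in>I. w i \<omega> * p i \<omega>) \<partial>M) = 0"
  using assms
\<comment> \<open>The rank is the negated stage, so the inserted index \<open>i\<close> has the
  smallest stage, and sets defined by \<open>w i\<close> are measurable at the stages of all other
  indices.\<close>
proof (induction I arbitrary: w rule: finite_ranking_induct[where f="\<lambda>i. - int (s i)"])
  case empty
  then show ?case by simp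
next
  case (insert i I)
  show ?case
  \<comment> \<open>The induction rule does not make the inserted index new; if it is old, the claim
    is the induction hypothesis.\<close>
  proof (cases "i \<in> I")
    case True
    then have eq: "insert i I = I" by auto
    show ?thesis
      unfolding eq by (rule insert.IH) (rule insert.prems[unfolded eq]; assumption)+
  next
    case False
    define S where "S \<omega> = (\<Sum>j\<in>insert i I. w j \<omega> * p j \<omega>)" for \<omega>
    have wM [measurable]: "w j \<in> borel_measurable M" if "j \<in> insert i I" for j
      using insert.prems(1,5) that by (blast intro: measurable_from_subalg)
    have pM [measurable]: "p j \<in> borel_measurable M" if "j \<in> insert i I" for j
      using insert.prems(3)[OF that] by auto
    have [measurable]: "S \<in> borel_measurable M"
      unfolding S_def by (intro borel_measurable_sum borel_measurable_times wM pM)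
    have [measurable]: "w i \<in> borel_measurable M" "p i \<in> borel_measurable M" by auto
    have pos: "integrable M (\<lambda>\<omega>. max 0 (S \<omega>))" using insert.prems(6) by (simp add: S_def)
    have trunc: "integrable M (\<lambda>\<omega>. if \<bar>w i \<omega>\<bar> \<le> real k then S \<omega> else 0) \<and>
        (\<integral>\<omega>. (if \<bar>w i \<omega>\<bar> \<le> real k then S \<omega> else 0) \<partial>M) = 0" for k
    proof -
      define w' where "w' j \<omega> = (if \<bar>w i \<omega>\<bar> \<le> real k then w j \<omega> else 0)" for j \<omega>
      have w'F: "w' j \<in> borel_measurable (F (s j))" if "j \<in> insert i I" for j
      proof -
        have "s i \<le> s j" using insert.hyps(2) that by force
        then have [measurable]: "w i \<in> borel_measurable (F (s j))"
          using insert.prems(2,5) that by (blast intro: measurable_from_subalg)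
        have [measurable]: "w j \<in> borel_measurable (F (s j))" using insert.prems(5) that by blast
        show ?thesis unfolding w'_def by measurable
      qed
      have w'M: "w' j \<in> borel_measurable M" if "j \<in> insert i I" for j
        using insert.prems(1) w'F that by (blast intro: measurable_from_subalg)
      have [measurable]: "w' i \<in> borel_measurable M" using w'M by auto
      have bdd: "\<bar>w' i \<omega>\<bar> \<le> real k" for \<omega> by (simp add: w'_def)
      have int_i: "integrable M (\<lambda>\<omega>. w' i \<omega> * p i \<omega>)"
      proof (rule Bochner_Integration.integrable_bound)
        show "integrable M (\<lambda>\<omega>. real k * p i \<omega>)" using insert.prems(3) by auto
        show "AE \<omega> in M. norm (w' i \<omega> * p i \<omega>) \<le> norm (real k * p i \<omega>)"
          using bdd by (auto simp: abs_mult intro!: mult_right_mono)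
      qed simp
      have zero_i: "(\<integral>\<omega>. w' i \<omega> * p i \<omega> \<partial>M) = 0"
        using insert.prems(4) w'F bdd by blast
      have split: "(if \<bar>w i \<omega>\<bar> \<le> real k then S \<omega> else 0) =
          w' i \<omega> * p i \<omega> + (\<Sum>j\<in>I. w' j \<omega> * p j \<omega>)" for \<omega>
        using False insert.hyps(1) by (simp add: S_def w'_def)
      have "integrable M (\<lambda>\<omega>. \<Sum>j\<in>I. w' j \<omega> * p j \<omega>) \<and>
          (\<integral>\<omega>. (\<Sum>j\<in>I. w' j \<omega> * p j \<omega>) \<partial>M) = 0"
      proof (rule insert.IH)
        \<comment> \<open>The remaining sum is the truncated \<open>S\<close> minus one integrable
          term, so its positive part is dominated.\<close>
        show "integrable M (\<lambda>\<omega>. max 0 (\<Sum>j\<in>I. w' j \<omega> * p j \<omega>))"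
        proof (rule Bochner_Integration.integrable_bound)
          show "integrable M (\<lambda>\<omega>. max 0 (S \<omega>) + \<bar>w' i \<omega> * p i \<omega>\<bar>)"
            using pos int_i by auto
          show "(\<lambda>\<omega>. max 0 (\<Sum>j\<in>I. w' j \<omega> * p j \<omega>)) \<in> borel_measurable M"
            by (intro borel_measurable_max borel_measurable_const borel_measurable_sum
                borel_measurable_times w'M pM) auto
          have "(\<Sum>j\<in>I. w' j \<omega> * p j \<omega>) \<le> max 0 (S \<omega>) + \<bar>w' i \<omega> * p i \<omega>\<bar>" for \<omega>
            using split[of \<omega>] by (auto split: if_splits)
          then show "AE \<omega> in M. norm (max 0 (\<Sum>j\<in>I. w' j \<omega> * p j \<omega>)) \<le>
              norm (max 0 (S \<omega>) + \<bar>w' i \<omega> * p i \<omega>\<bar>)"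
            by (simp add: abs_le_iff) 
        qed
      next
        fix j C and v :: "'w \<Rightarrow> real"
        assume "j \<in> I" "v \<in> borel_measurable (F (s j))" "\<And>\<omega>. \<bar>v \<omega>\<bar> \<le> C"
        then show "(\<integral>\<omega>. v \<omega> * p j \<omega> \<partial>M) = 0"
          by (intro insert.prems(4)[of j v C]) auto
      qed (use insert.prems(1-3) w'F in auto)
      then show ?thesis unfolding split using int_i zero_i by simp
    qed
    \<comment> \<open>On each truncation set the negative part is the positive part minus
      \<open>S\<close>, and \<open>S\<close> has mean zero there. Hence its integral is at most that
      of \<open>max 0 (S \<omega>)\<close>, uniformly in \<open>k\<close>.\<close>
    have neg: "integrable M (\<lambda>\<omega>. max 0 (- S \<omega>))"
    proof (rule integrable_of_bounded_truncations[where a="w i" and d="\<integral>\<omega>. max 0 (S \<omega>) \<partial>M"])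
      fix k
      have eq: "(if \<bar>w i \<omega>\<bar> \<le> real k then max 0 (- S \<omega>) else 0) =
          (if \<bar>w i \<omega>\<bar> \<le> real k then max 0 (S \<omega>) else 0) - (if \<bar>w i \<omega>\<bar> \<le> real k then S \<omega> else 0)"
        for \<omega> by auto
      have int: "integrable M (\<lambda>\<omega>. if \<bar>w i \<omega>\<bar> \<le> real k then max 0 (S \<omega>) else 0)"
        using pos by (intro integrable_truncation) auto
      show "integrable M (\<lambda>\<omega>. if \<bar>w i \<omega>\<bar> \<le> real k then max 0 (- S \<omega>) else 0)"
        unfolding eq using int trunc[of k] by auto
      have "(\<integral>\<omega>. (if \<bar>w i \<omega>\<bar> \<le> real k then max 0 (- S \<omega>) else 0) \<partial>M) =
          (\<integral>\<omega>. (if \<bar>w i \<omega>\<bar> \<le> real k then max 0 (S \<omega>) else 0) \<partial>M)"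
        unfolding eq using int trunc[of k] by simp
      also have "\<dots> \<le> (\<integral>\<omega>. max 0 (S \<omega>) \<partial>M)"
        using int pos by (intro integral_mono) auto
      finally show "(\<integral>\<omega>. (if \<bar>w i \<omega>\<bar> \<le> real k then max 0 (- S \<omega>) else 0) \<partial>M) \<le>
          (\<integral>\<omega>. max 0 (S \<omega>) \<partial>M)" .
    qed auto
    have "S = (\<lambda>\<omega>. max 0 (S \<omega>) - max 0 (- S \<omega>))" by auto
    then have int: "integrable M S"
      using Bochner_Integration.integrable_diff[OF pos neg] by simp
    have "(\<lambda>k. \<integral>\<omega>. (if \<bar>w i \<omega>\<bar> \<le> real k then S \<omega> else 0) \<partial>M) \<longlonglongrightarrow> (\<integral>\<omega>. S \<omega> \<partial>M)"
      using int by (intro integral_truncation_tendsto) auto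
    then have "(\<integral>\<omega>. S \<omega> \<partial>M) = 0"
      using trunc by (simp add: LIMSEQ_const_iff)
    with int show ?thesis by (simp add: S_def[abs_def])
  qed
qed


section \<open>Solid decomposable spaces\<close>

lemma solid_decomposable_spaceD:
  assumes "solid_decomposable_space M X"
  shows "u \<in> X \<Longrightarrow> u \<in> borel_measurable M"
    and "u \<in> X \<Longrightarrow> v \<in> X \<Longrightarrow> (\<lambda>\<omega>. u \<omega> + v \<omega>) \<in> X"
    and "u \<in> X \<Longrightarrow> (\<lambda>\<omega>. c *\<^sub>R u \<omega>) \<in> X"
    and "v \<in> X \<Longrightarrow> u \<in> borel_measurable M \<Longrightarrow>
      (\<And>\<omega> i. \<omega> \<in> space M \<Longrightarrow> \<bar>u \<omega> $ i\<bar> \<le> \<bar>v \<omega> $ i\<bar>) \<Longrightarrow> u \<in> X"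
  using assms unfolding solid_decomposable_space_def rv_linear_space_def solid_def by auto

lemma L_infty_subset_solid_decomposable_space:
  fixes X :: "('w \<Rightarrow> real ^ 'n::finite) set"
  assumes X: "solid_decomposable_space M X"
  shows "L_infty M \<subseteq> X"
proof
  fix u :: "'w \<Rightarrow> real ^ 'n" assume u: "u \<in> L_infty M"
  \<comment> \<open>Decomposability is applied to the zero function and the empty set. The result
    agrees with \<open>u\<close> only on \<open>space M\<close>; solidity passes from it to
    \<open>u\<close>.\<close>
  let ?v = "\<lambda>\<omega>. indicator {} \<omega> *\<^sub>R 0 + indicator (space M - {}) \<omega> *\<^sub>R u \<omega>"
  have zero: "(\<lambda>_. 0) \<in> X" and dec: "decomposable M X"
    using X by (auto simp: solid_decomposable_space_def rv_linear_space_def)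
  have "?v \<in> X"
    using dec[unfolded decomposable_def, rule_format, OF zero u sets.empty_sets] .
  then show "u \<in> X"
    by (rule solid_decomposable_spaceD(4)[OF X]) (use u in \<open>auto simp: L_infty_def\<close>)
qed

text \<open>On \<open>A\<close> the function \<open>x\<close>, possibly outside \<open>X\<close>,
  differs from \<open>z\<close> by a bounded function. The pasted function is thus the sum of a
  member of \<open>L_infty M\<close> and two cut-offs that solidity keeps in
  \<open>X\<close>.\<close>

lemma paste_in_solid_decomposable_space:
  assumes X: "solid_decomposable_space M X"
    and [measurable]: "x \<in> borel_measurable M" "A \<in> sets M"
    and x': "x' \<in> X" and z: "z \<in> X"
    and bound: "\<And>\<omega>. \<omega> \<in> A \<Longrightarrow> norm (x \<omega> - z \<omega>) \<le> C"
  shows "(\<lambda>\<omega>. if \<omega> \<in> A then x \<omega> else x' \<omega>) \<in> X"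
proof -
  have [measurable]: "x' \<in> borel_measurable M" "z \<in> borel_measurable M"
    using solid_decomposable_spaceD(1)[OF X] x' z by auto
  have "(\<lambda>\<omega>. if \<omega> \<in> A then x \<omega> - z \<omega> else 0) \<in> L_infty M"
    unfolding L_infty_def
  \<comment> \<open>\<open>C\<close> may be negative when \<open>A\<close> is empty, and the cut-off
    vanishes outside \<open>A\<close>; hence the maximum with 0.\<close>
  proof (intro CollectI conjI exI[of _ "max 0 C"] AE_I2)
    show "norm (if \<omega> \<in> A then x \<omega> - z \<omega> else 0) \<le> max 0 C" for \<omega>
      using bound[of \<omega>] by auto
  qed measurable
  then have d: "(\<lambda>\<omega>. if \<omega> \<in> A then x \<omega> - z \<omega> else 0) \<in> X"
    using L_infty_subset_solid_decomposable_space[OF X] by blast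
  have zA: "(\<lambda>\<omega>. if \<omega> \<in> A then z \<omega> else 0) \<in> X"
    by (rule solid_decomposable_spaceD(4)[OF X z]) auto
  have x'A: "(\<lambda>\<omega>. if \<omega> \<in> A then 0 else x' \<omega>) \<in> X"
    by (rule solid_decomposable_spaceD(4)[OF X x']) auto
  have "(\<lambda>\<omega>. if \<omega> \<in> A then x \<omega> else x' \<omega>) =
      (\<lambda>\<omega>. (if \<omega> \<in> A then x \<omega> - z \<omega> else 0) +
        ((if \<omega> \<in> A then z \<omega> else 0) + (if \<omega> \<in> A then 0 else x' \<omega>)))"
    by auto
  also have "\<dots> \<in> X"
    using solid_decomposable_spaceD(2)[OF X d solid_decomposable_spaceD(2)[OF X zA x'A]] .
  finally show ?thesis .
qed

section \<open>Nonanticipative processes\<close>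

lemma adapted_scaleR:
  "adapted T F stage x \<Longrightarrow> adapted T F stage (\<lambda>\<omega>. c *\<^sub>R x \<omega>)"
  by (auto simp: adapted_def intro!: borel_measurable_times)

lemma nonanticipative_scaleR:
  assumes "x \<in> nonanticipative M T F stage"
  shows "(\<lambda>\<omega>. c *\<^sub>R x \<omega>) \<in> nonanticipative M T F stage"
proof -
  obtain x' where "x \<in> borel_measurable M" "adapted T F stage x'" "AE \<omega> in M. x \<omega> = x' \<omega>"
    using assms by (auto simp: nonanticipative_def)
  then show ?thesis
    unfolding nonanticipative_def by (auto intro!: exI[of _ "\<lambda>\<omega>. c *\<^sub>R x' \<omega>"] adapted_scaleR)
qed

lemma zero_nonanticipative: "(\<lambda>_. 0) \<in> nonanticipative M T F stage"
  unfolding nonanticipative_def by (auto intro!: exI[of _ "\<lambda>_. 0"] simp: adapted_def)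

text \<open>Reduces to \<open>integral_adapted_sum_eq_0\<close> for the coordinates of an adapted
  representative of \<open>w\<close>. Its orthogonality condition is tested on bounded processes
  with a single nonzero coordinate, which lie in \<open>X\<close>.\<close>

lemma (in prob_space) integral_nonanticipative_eq_0:
  fixes X V :: "('a \<Rightarrow> real ^ 'n::finite) set" and stage :: "'n \<Rightarrow> nat"
  assumes filt: "finite_filtration M T F" and stage: "\<And>i. stage i \<le> T"
    and X: "solid_decomposable_space M X" and V: "solid_decomposable_space M V"
    and XV: "separating_duality M X V" and p: "p \<in> V"
    and orth: "\<And>w. w \<in> X \<Longrightarrow> w \<in> nonanticipative M T F stage \<Longrightarrow> pairing M w p = 0"
    and w: "w \<in> nonanticipative M T F stage"
    and pos: "integrable M (\<lambda>\<omega>. max 0 (w \<omega> \<bullet> p \<omega>))"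
  shows "integrable M (\<lambda>\<omega>. w \<omega> \<bullet> p \<omega>)" "(\<integral>\<omega>. w \<omega> \<bullet> p \<omega> \<partial>M) = 0"
proof -
  have [measurable]: "p \<in> borel_measurable M" using solid_decomposable_spaceD(1)[OF V p] .
  have p_nth [measurable]: "(\<lambda>\<omega>. p \<omega> $ i) \<in> borel_measurable M" for i
    unfolding cart_eq_inner_axis by measurable
  have sub: "subalgebra M (F (stage i))" for i
    using filt stage by (auto simp: finite_filtration_def)
  obtain w' where w_meas [measurable]: "w \<in> borel_measurable M"
    and w': "adapted T F stage w'" and ww': "AE \<omega> in M. w \<omega> = w' \<omega>"
    using w by (auto simp: nonanticipative_def)
  have w'_nth: "(\<lambda>\<omega>. w' \<omega> $ i) \<in> borel_measurable (F (stage i))" for i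
    using w' stage by (auto simp: adapted_def)
  have [measurable]: "(\<lambda>\<omega>. w' \<omega> $ i) \<in> borel_measurable M" for i
    using measurable_from_subalg[OF sub w'_nth] .
  have in_X: "(\<lambda>\<omega>. axis i (v \<omega>)) \<in> X"
    if "v \<in> borel_measurable M" "\<And>\<omega>. \<bar>v \<omega>\<bar> \<le> C" for i v C
  proof -
    have "(\<lambda>\<omega>. axis i (v \<omega>)) = (\<lambda>\<omega>. v \<omega> *\<^sub>R axis i 1)"
      by (auto simp: vec_eq_iff axis_def)
    also have "\<dots> \<in> L_infty M"
      using that by (auto simp: L_infty_def intro!: exI[of _ C])
    finally show ?thesis using L_infty_subset_solid_decomposable_space[OF X] by blast
  qed
  have eq: "(\<Sum>i\<in>UNIV. w' \<omega> $ i * p \<omega> $ i) = w' \<omega> \<bullet> p \<omega>" for \<omega>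
    by (simp add: inner_vec_def)
  have AE_eq: "AE \<omega> in M. w \<omega> \<bullet> p \<omega> = (\<Sum>i\<in>UNIV. w' \<omega> $ i * p \<omega> $ i)"
    using ww' by eventually_elim (simp add: eq)
  have *: "integrable M (\<lambda>\<omega>. \<Sum>i\<in>UNIV. w' \<omega> $ i * p \<omega> $ i) \<and>
    (\<integral>\<omega>. (\<Sum>i\<in>UNIV. w' \<omega> $ i * p \<omega> $ i) \<partial>M) = 0"
  proof (rule integral_adapted_sum_eq_0[where F=F and s=stage])
    fix i
    \<comment> \<open>Pairing with a constant unit vector, a member of \<open>X\<close>, isolates a
      coordinate of \<open>p\<close>.\<close>
    have "(\<lambda>_. axis i 1) \<in> X" by (rule in_X[of _ 1]) auto
    then have "integrable M (\<lambda>\<omega>. axis i 1 \<bullet> p \<omega>)"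
      using XV p by (auto simp: separating_duality_def)
    then show "integrable M (\<lambda>\<omega>. p \<omega> $ i)" by (simp add: inner_axis')
  next
    fix i C and v :: "'a \<Rightarrow> real"
    assume v: "v \<in> borel_measurable (F (stage i))" and C: "\<And>\<omega>. \<bar>v \<omega>\<bar> \<le> C"
    have [measurable]: "v \<in> borel_measurable M" using measurable_from_subalg[OF sub v] .
    have x: "(\<lambda>\<omega>. axis i (v \<omega>)) \<in> X" by (rule in_X[OF _ C]) simp
    have "adapted T F stage (\<lambda>\<omega>. axis i (v \<omega>))"
      unfolding adapted_def
    proof (intro allI impI)
      fix t j assume "stage j = t"
      then show "(\<lambda>\<omega>. axis i (v \<omega>) $ j) \<in> borel_measurable (F t)"
        using v by (cases "i = j") (auto simp: axis_def)
    qed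
    then have "(\<lambda>\<omega>. axis i (v \<omega>)) \<in> nonanticipative M T F stage"
      using solid_decomposable_spaceD(1)[OF X x] by (auto simp: nonanticipative_def)
    from orth[OF x this] show "(\<integral>\<omega>. v \<omega> * p \<omega> $ i \<partial>M) = 0"
      by (simp add: pairing_def inner_axis')
  next
    have "AE \<omega> in M. max 0 (w \<omega> \<bullet> p \<omega>) = max 0 (\<Sum>i\<in>UNIV. w' \<omega> $ i * p \<omega> $ i)"
      using AE_eq by eventually_elim simp
    then show "integrable M (\<lambda>\<omega>. max 0 (\<Sum>i\<in>UNIV. w' \<omega> $ i * p \<omega> $ i))"
      by (subst integrable_cong_AE[symmetric, where f="\<lambda>\<omega>. max 0 (w \<omega> \<bullet> p \<omega>)"])
        (use pos in auto)
  qed (use sub w'_nth filt stage in \<open>auto simp: finite_filtration_def\<close>)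
  show "integrable M (\<lambda>\<omega>. w \<omega> \<bullet> p \<omega>)"
    using * AE_eq by (subst integrable_cong_AE) auto
  show "(\<integral>\<omega>. w \<omega> \<bullet> p \<omega> \<partial>M) = 0"
    using * AE_eq by (subst integral_cong_AE) auto
qed


section \<open>Strategies outside the primal space\<close>

text \<open>
  On sets where \<open>x - z\<close> is bounded, \<open>x\<close> pasted with \<open>x'\<close> belongs to \<open>X\<close>, so the bound \<open>c\<close> applies to
  it. Choosing the sets inside \<open>{h' \<le> h}\<close>, where \<open>h\<close> and \<open>h'\<close> are the integrands of the dual
  objective at \<open>x\<close> and \<open>x'\<close>, bounds the positive part of \<open>h - h'\<close>, and hence of \<open>(x - z) \<bullet> p\<close>, in
  \<open>L\<^sup>1\<close>. Then \<open>(x - z) \<bullet> p\<close> has mean zero, and one may let the truncation level tend to infinity.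
\<close>
lemma (in prob_space) pairing_minus_integral_le:
  fixes f :: "(real ^ 'n::finite) \<times> (real ^ 'm::finite) \<Rightarrow> 'a \<Rightarrow> ereal"
    and X V :: "('a \<Rightarrow> real ^ 'n) set" and U Y :: "('a \<Rightarrow> real ^ 'm) set"
    and T :: nat and F :: "nat \<Rightarrow> 'a measure" and stage :: "'n \<Rightarrow> nat"
  defines "N \<equiv> nonanticipative M T F stage"
  assumes filt: "finite_filtration M T F" and stage: "\<And>i. stage i \<le> T"
    and X: "solid_decomposable_space M X" and V: "solid_decomposable_space M V"
    and XV: "separating_duality M X V"
    and U: "solid_decomposable_space M U" and Y: "solid_decomposable_space M Y"
    and UY: "separating_duality M U Y"
    and p: "p \<in> V" and y: "y \<in> Y"
    and x': "x' \<in> X" and u': "u' \<in> U"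
    and r': "integrable M r'" "AE \<omega> in M. f (x' \<omega>, u' \<omega>) \<omega> \<le> ereal (r' \<omega>)"
    and bound: "\<And>x z u r. x \<in> X \<Longrightarrow> z \<in> X \<Longrightarrow> (\<lambda>\<omega>. x \<omega> - z \<omega>) \<in> N \<Longrightarrow> u \<in> U \<Longrightarrow> integrable M r \<Longrightarrow>
      (AE \<omega> in M. f (x \<omega>, u \<omega>) \<omega> \<le> ereal (r \<omega>)) \<Longrightarrow>
      pairing M z p + pairing M u y - (\<integral>\<omega>. r \<omega> \<partial>M) \<le> c"
    and x [measurable]: "x \<in> borel_measurable M" and z: "z \<in> X" and xz: "(\<lambda>\<omega>. x \<omega> - z \<omega>) \<in> N"
    and u: "u \<in> U"
    and r: "integrable M r" "AE \<omega> in M. f (x \<omega>, u \<omega>) \<omega> \<le> ereal (r \<omega>)"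
  shows "pairing M z p + pairing M u y - (\<integral>\<omega>. r \<omega> \<partial>M) \<le> c"
proof -
  have intX: "integrable M (\<lambda>\<omega>. v \<omega> \<bullet> p \<omega>)" if "v \<in> X" for v
    using XV p that by (auto simp: separating_duality_def)
  have intU: "integrable M (\<lambda>\<omega>. v \<omega> \<bullet> y \<omega>)" if "v \<in> U" for v
    using UY y that by (auto simp: separating_duality_def)
  have [measurable]: "p \<in> borel_measurable M" "y \<in> borel_measurable M" "z \<in> borel_measurable M"
      "x' \<in> borel_measurable M" "u \<in> borel_measurable M" "u' \<in> borel_measurable M"
      "r \<in> borel_measurable M" "r' \<in> borel_measurable M"
    using solid_decomposable_spaceD(1)[OF V p] solid_decomposable_spaceD(1)[OF Y y]
      solid_decomposable_spaceD(1)[OF X z] solid_decomposable_spaceD(1)[OF X x']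
      solid_decomposable_spaceD(1)[OF U u] solid_decomposable_spaceD(1)[OF U u'] r(1) r'(1) by auto

  \<comment> \<open>The strategy stays at \<open>x'\<close> and only the parameter moves, from
    \<open>x'\<close> to \<open>x' + t w\<close>. This is feasible, keeps \<open>r'\<close> and
    makes the bound affine in \<open>t\<close>, so its slope must vanish.\<close>
  have orth: "pairing M w p = 0" if w: "w \<in> X" "w \<in> N" for w
  proof (rule ccontr)
    assume nz: "pairing M w p \<noteq> 0"
    define d where "d = c - (pairing M x' p + pairing M u' y - (\<integral>\<omega>. r' \<omega> \<partial>M))"
    have "t * pairing M w p \<le> d" for t
    proof -
      have z': "(\<lambda>\<omega>. x' \<omega> + t *\<^sub>R w \<omega>) \<in> X"
        using solid_decomposable_spaceD(2)[OF X x' solid_decomposable_spaceD(3)[OF X w(1)]] .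
      have "(\<lambda>\<omega>. x' \<omega> - (x' \<omega> + t *\<^sub>R w \<omega>)) = (\<lambda>\<omega>. (- t) *\<^sub>R w \<omega>)" by auto
      also have "\<dots> \<in> N" using w(2) unfolding N_def by (rule nonanticipative_scaleR)
      finally have "pairing M (\<lambda>\<omega>. x' \<omega> + t *\<^sub>R w \<omega>) p + pairing M u' y - (\<integral>\<omega>. r' \<omega> \<partial>M) \<le> c"
        using bound[OF x' z' _ u' r'] by blast
      moreover have "pairing M (\<lambda>\<omega>. x' \<omega> + t *\<^sub>R w \<omega>) p = pairing M x' p + t * pairing M w p"
        unfolding pairing_def by (simp add: inner_add_left intX x' w)
      ultimately show ?thesis by (simp add: d_def)
    qed
    \<comment> \<open>This \<open>t\<close> turns the bound into
      \<open>d + 1 \<le> d\<close>.\<close>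
    from this[of "(d + 1) / pairing M w p"] nz show False by simp
  qed

  \<comment> \<open>The difference \<open>g\<close> of the dual integrands at \<open>x\<close> and
    \<open>x'\<close> is split into \<open>q\<close>, integrable by the dualities and the choice of
    \<open>r\<close> and \<open>r'\<close>, and the critical term
    \<open>w \<bullet> p\<close>.\<close>
  define q where "q \<omega> = (z \<omega> \<bullet> p \<omega> + u \<omega> \<bullet> y \<omega> - r \<omega>) - (x' \<omega> \<bullet> p \<omega> + u' \<omega> \<bullet> y \<omega> - r' \<omega>)" for \<omega>
  define w where "w \<omega> = x \<omega> - z \<omega>" for \<omega>
  define g where "g \<omega> = w \<omega> \<bullet> p \<omega> + q \<omega>" for \<omega>
  define d where "d = c - (\<integral>\<omega>. x' \<omega> \<bullet> p \<omega> + u' \<omega> \<bullet> y \<omega> - r' \<omega> \<partial>M)"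
  have int_q: "integrable M q"
    unfolding q_def using intX x' z intU u u' r(1) r'(1)
    by (intro Bochner_Integration.integrable_diff Bochner_Integration.integrable_add) auto
  have [measurable]: "w \<in> borel_measurable M" "q \<in> borel_measurable M" "g \<in> borel_measurable M"
    unfolding w_def q_def g_def by measurable
  have on_sets: "integrable M (\<lambda>\<omega>. if \<omega> \<in> A then g \<omega> else 0) \<and>
      (\<integral>\<omega>. (if \<omega> \<in> A then g \<omega> else 0) \<partial>M) \<le> d"
    if A [measurable]: "A \<in> sets M" and bd: "\<And>\<omega>. \<omega> \<in> A \<Longrightarrow> norm (w \<omega>) \<le> C" for A C
  proof -
    let ?x = "\<lambda>\<omega>. if \<omega> \<in> A then x \<omega> else x' \<omega>"
    let ?u = "\<lambda>\<omega>. if \<omega> \<in> A then u \<omega> else u' \<omega>"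
    let ?r = "\<lambda>\<omega>. if \<omega> \<in> A then r \<omega> else r' \<omega>"
    let ?h' = "\<lambda>\<omega>. x' \<omega> \<bullet> p \<omega> + u' \<omega> \<bullet> y \<omega> - r' \<omega>"
    have xX: "?x \<in> X"
      by (rule paste_in_solid_decomposable_space[OF X _ _ x' z]) (use bd in \<open>auto simp: w_def\<close>)
    have uU: "?u \<in> U"
      by (rule paste_in_solid_decomposable_space[OF U _ _ u' u, where C=0]) auto
    have int_r: "integrable M ?r"
      by (rule Bochner_Integration.integrable_bound[where f="\<lambda>\<omega>. \<bar>r \<omega>\<bar> + \<bar>r' \<omega>\<bar>"]) (use r r' in auto)
    have le: "AE \<omega> in M. f (?x \<omega>, ?u \<omega>) \<omega> \<le> ereal (?r \<omega>)"
      using r(2) r'(2) by eventually_elim auto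
    \<comment> \<open>The pasted strategy serves as its own parameter, so the constraint is trivial
      and the pairing sees \<open>x\<close> on \<open>A\<close>. Subtracting \<open>?h'\<close> then
      leaves \<open>g\<close> on \<open>A\<close> and 0 elsewhere.\<close>
    have "(\<lambda>\<omega>. ?x \<omega> - ?x \<omega>) \<in> N"
      unfolding N_def using zero_nonanticipative by simp
    from bound[OF xX xX this uU int_r le]
    have "pairing M ?x p + pairing M ?u y - (\<integral>\<omega>. ?r \<omega> \<partial>M) \<le> c" .
    moreover have "pairing M ?x p + pairing M ?u y - (\<integral>\<omega>. ?r \<omega> \<partial>M) =
        (\<integral>\<omega>. ?x \<omega> \<bullet> p \<omega> + ?u \<omega> \<bullet> y \<omega> - ?r \<omega> \<partial>M)"
      unfolding pairing_def by (simp add: intX[OF xX] intU[OF uU] int_r)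
    moreover have int: "integrable M (\<lambda>\<omega>. ?x \<omega> \<bullet> p \<omega> + ?u \<omega> \<bullet> y \<omega> - ?r \<omega>)" "integrable M ?h'"
      using intX[OF xX] intU[OF uU] int_r intX[OF x'] intU[OF u'] r'(1) by auto
    moreover have eq: "(\<lambda>\<omega>. if \<omega> \<in> A then g \<omega> else 0) =
        (\<lambda>\<omega>. (?x \<omega> \<bullet> p \<omega> + ?u \<omega> \<bullet> y \<omega> - ?r \<omega>) - ?h' \<omega>)"
      by (auto simp: g_def w_def q_def inner_diff_left)
    ultimately show ?thesis
      unfolding eq d_def by (simp only: Bochner_Integration.integrable_diff Bochner_Integration.integral_diff) simp
  qed

  have int_pos: "integrable M (\<lambda>\<omega>. max 0 (g \<omega>))"
  proof (rule integrable_of_bounded_truncations[where a="\<lambda>\<omega>. norm (w \<omega>)" and d=d])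
    fix k :: nat
    define A where "A = {\<omega> \<in> space M. norm (w \<omega>) \<le> real k \<and> 0 \<le> g \<omega>}"
    have A: "integrable M (\<lambda>\<omega>. if \<omega> \<in> A then g \<omega> else 0) \<and>
        (\<integral>\<omega>. (if \<omega> \<in> A then g \<omega> else 0) \<partial>M) \<le> d"
      by (rule on_sets[of A "real k"]) (auto simp: A_def)
    have eq: "(if \<bar>norm (w \<omega>)\<bar> \<le> real k then max 0 (g \<omega>) else 0) = (if \<omega> \<in> A then g \<omega> else 0)"
      if "\<omega> \<in> space M" for \<omega>
      using that by (auto simp: A_def max_def)
    show "integrable M (\<lambda>\<omega>. if \<bar>norm (w \<omega>)\<bar> \<le> real k then max 0 (g \<omega>) else 0)"
      using A by (subst Bochner_Integration.integrable_cong[OF refl eq]) auto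
    show "(\<integral>\<omega>. (if \<bar>norm (w \<omega>)\<bar> \<le> real k then max 0 (g \<omega>) else 0) \<partial>M) \<le> d"
      using A by (subst Bochner_Integration.integral_cong[OF refl eq]) auto
  qed auto
  \<comment> \<open>\<open>w \<bullet> p\<close> equals \<open>g - q\<close>, so its positive part
    is at most \<open>max 0 g + \<bar>q\<bar>\<close>.\<close>
  have wp_pos: "integrable M (\<lambda>\<omega>. max 0 (w \<omega> \<bullet> p \<omega>))"
    by (rule Bochner_Integration.integrable_bound[where f="\<lambda>\<omega>. max 0 (g \<omega>) + \<bar>q \<omega>\<bar>"])
      (use int_pos int_q in \<open>auto simp: g_def\<close>)
  have "w \<in> nonanticipative M T F stage"
    using xz by (simp add: N_def w_def[abs_def])
  note int_wp = integral_nonanticipative_eq_0[OF filt stage X V XV p orth[unfolded N_def] this wp_pos]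
  have wp: "integrable M (\<lambda>\<omega>. w \<omega> \<bullet> p \<omega>)" "(\<integral>\<omega>. w \<omega> \<bullet> p \<omega> \<partial>M) = 0"
    by (rule int_wp; assumption)+
  have g_eq: "g = (\<lambda>\<omega>. w \<omega> \<bullet> p \<omega> + q \<omega>)" by (rule ext) (rule g_def)
  have int_g: "integrable M g"
    unfolding g_eq using wp(1) int_q by (rule Bochner_Integration.integrable_add)
  have g: "(\<integral>\<omega>. g \<omega> \<partial>M) = (\<integral>\<omega>. q \<omega> \<partial>M)"
    unfolding g_eq Bochner_Integration.integral_add[OF wp(1) int_q] wp(2) by simp
  \<comment> \<open>Now that \<open>g\<close> is integrable, \<open>on_sets\<close> is applied to
    the full sets where \<open>norm (w \<omega>) \<le> real k\<close>, and the bound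
    \<open>d\<close> passes to the limit.\<close>
  have "(\<integral>\<omega>. g \<omega> \<partial>M) \<le> d"
  proof (rule LIMSEQ_le_const2)
    show "(\<lambda>k. \<integral>\<omega>. (if \<bar>norm (w \<omega>)\<bar> \<le> real k then g \<omega> else 0) \<partial>M) \<longlonglongrightarrow> (\<integral>\<omega>. g \<omega> \<partial>M)"
      by (rule integral_truncation_tendsto[OF int_g]) measurable
    have "(\<integral>\<omega>. (if \<bar>norm (w \<omega>)\<bar> \<le> real k then g \<omega> else 0) \<partial>M) \<le> d" for k
    proof -
      let ?A = "{\<omega> \<in> space M. norm (w \<omega>) \<le> real k}"
      have "(\<integral>\<omega>. (if \<bar>norm (w \<omega>)\<bar> \<le> real k then g \<omega> else 0) \<partial>M) =
          (\<integral>\<omega>. (if \<omega> \<in> ?A then g \<omega> else 0) \<partial>M)"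
        by (rule Bochner_Integration.integral_cong[OF refl]) simp
      also have "\<dots> \<le> d"
        by (rule conjunct2[OF on_sets[of ?A "real k"]]) auto
      finally show ?thesis .
    qed
    then show "\<exists>n. \<forall>k\<ge>n. (\<integral>\<omega>. (if \<bar>norm (w \<omega>)\<bar> \<le> real k then g \<omega> else 0) \<partial>M) \<le> d"
      by (intro exI allI impI)
  qed
  \<comment> \<open>The integral of \<open>g\<close> is that of \<open>q\<close>, in which
    \<open>z\<close> stands in place of \<open>x\<close>; the primed terms cancel against those in
    \<open>d\<close>.\<close>
  moreover have "(\<integral>\<omega>. q \<omega> \<partial>M) = pairing M z p + pairing M u y - (\<integral>\<omega>. r \<omega> \<partial>M) -
      (\<integral>\<omega>. x' \<omega> \<bullet> p \<omega> + u' \<omega> \<bullet> y \<omega> - r' \<omega> \<partial>M)"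
    unfolding q_def pairing_def using intX[OF z] intX[OF x'] intU[OF u] intU[OF u'] r(1) r'(1) by simp
  ultimately show ?thesis by (simp add: g d_def)
qed

section \<open>Equality of the two conjugates\<close>

theorem lemma21:
  fixes M :: "'w measure"
    and T :: nat
    and F :: "nat \<Rightarrow> 'w measure"
    and stage :: "'n::finite \<Rightarrow> nat"
    and f :: "(real ^ 'n) \<times> (real ^ 'm::finite) \<Rightarrow> 'w \<Rightarrow> ereal"
    and X V :: "('w \<Rightarrow> real ^ 'n) set"
    and U Y :: "('w \<Rightarrow> real ^ 'm) set"
  defines "N \<equiv> nonanticipative M T F stage"
  defines "\<phi> \<equiv> value_function M f N X"
    and "\<phi>bar \<equiv> value_function M f N (borel_measurable M)"
  assumes "prob_space M"
    and "finite_filtration M T F"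
    and "\<forall>i. stage i \<le> T"
    and "convex_normal_integrand M f"
    and "solid_decomposable_space M X" "solid_decomposable_space M V"
    and "separating_duality M X V"
    and "solid_decomposable_space M U" "solid_decomposable_space M Y"
    and "separating_duality M U Y"
    and "\<exists>x\<in>X. \<exists>u\<in>U. integral_functional M f x u < \<infinity>"
  shows "\<forall>p\<in>V. \<forall>y\<in>Y. conjugate M X U \<phi> p y = conjugate M X U \<phi>bar p y"
proof (intro ballI antisym)
  fix p y assume p: "p \<in> V" and y: "y \<in> Y"
  interpret prob_space M by fact
  note X = \<open>solid_decomposable_space M X\<close> and U = \<open>solid_decomposable_space M U\<close>
  have "\<phi>bar z u \<le> \<phi> z u" for z u
    unfolding \<phi>_def \<phi>bar_def value_function_def
    using solid_decomposable_spaceD(1)[OF X] by (intro INF_superset_mono) auto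
  then show "conjugate M X U \<phi> p y \<le> conjugate M X U \<phi>bar p y"
    unfolding conjugate_def by (intro SUP_mono') (auto intro!: ereal_minus_mono split: prod.splits)

  have majorant: "\<exists>r. integrable M r \<and> (AE \<omega> in M. f (x \<omega>, u \<omega>) \<omega> \<le> ereal (r \<omega>)) \<and> (\<integral>\<omega>. r \<omega> \<partial>M) < a"
    if x [measurable]: "x \<in> borel_measurable M" and u: "u \<in> U"
      and less: "integral_functional M f x u < ereal a" for x u a
  proof -
    have [measurable]: "u \<in> borel_measurable M" using solid_decomposable_spaceD(1)[OF U u] .
    have "(\<lambda>\<omega>. f (x \<omega>, u \<omega>) \<omega>) \<in> borel_measurable M"
      using \<open>convex_normal_integrand M f\<close>
      by (rule borel_measurable_normal_integrand[where x="\<lambda>\<omega>. (x \<omega>, u \<omega>)"]) (intro borel_measurable_Pair, auto)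
    then show ?thesis
      using less unfolding integral_functional_def
      by (rule ext_expectation_less_obtain_majorant) blast
  qed
  obtain x' u' where x': "x' \<in> X" and u': "u' \<in> U" and "integral_functional M f x' u' < \<infinity>"
    using \<open>\<exists>x\<in>X. \<exists>u\<in>U. integral_functional M f x u < \<infinity>\<close> by blast
  then obtain n :: nat where "integral_functional M f x' u' < ereal n"
    using less_PInf_Ex_of_nat[of "integral_functional M f x' u'"] by auto
  then obtain r' where r': "integrable M r'" "AE \<omega> in M. f (x' \<omega>, u' \<omega>) \<omega> \<le> ereal (r' \<omega>)"
    using majorant[OF solid_decomposable_spaceD(1)[OF X x'] u'] by blast

  \<comment> \<open>Lower bounds for the conjugate in terms of majorants \<open>r\<close>, so that
    the left side is a real number even if the expectation is \<open>-\<infinity>\<close>.\<close>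
  have le_conj: "ereal (pairing M z p + pairing M u y - (\<integral>\<omega>. r \<omega> \<partial>M)) \<le> conjugate M X U \<phi> p y"
    if x: "x \<in> X" and z: "z \<in> X" and xz: "(\<lambda>\<omega>. x \<omega> - z \<omega>) \<in> N" and u: "u \<in> U"
      and r: "integrable M r" "AE \<omega> in M. f (x \<omega>, u \<omega>) \<omega> \<le> ereal (r \<omega>)" for x z u r
  proof -
    have "\<phi> z u \<le> integral_functional M f x u"
      unfolding \<phi>_def value_function_def using x xz by (intro INF_lower) auto
    also have "\<dots> \<le> ereal (\<integral>\<omega>. r \<omega> \<partial>M)"
      unfolding integral_functional_def using r by (rule ext_expectation_le_integral)
    finally have "ereal (pairing M z p + pairing M u y) - ereal (\<integral>\<omega>. r \<omega> \<partial>M) \<le>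
        ereal (pairing M z p + pairing M u y) - \<phi> z u"
      by (intro ereal_minus_mono) auto
    also have "\<dots> \<le> conjugate M X U \<phi> p y"
      unfolding conjugate_def using z u by (intro SUP_upper2[of "(z, u)"]) auto
    finally show ?thesis by simp
  qed
  show "conjugate M X U \<phi>bar p y \<le> conjugate M X U \<phi> p y"
  proof (cases "conjugate M X U \<phi> p y")
    case PInf
    then show ?thesis by simp
  next
    \<comment> \<open>Excluded, since the feasible pair \<open>x'\<close>, \<open>u'\<close> bounds
      the conjugate below by a real number.\<close>
    case MInf
    have "(\<lambda>\<omega>. x' \<omega> - x' \<omega>) \<in> N" by (simp add: N_def zero_nonanticipative)
    from le_conj[OF x' x' this u' r'] MInf show ?thesis by simp
  next
    case (real c)
    have bound: "pairing M z p + pairing M u y - (\<integral>\<omega>. r \<omega> \<partial>M) \<le> c"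
      if "x \<in> X" "z \<in> X" "(\<lambda>\<omega>. x \<omega> - z \<omega>) \<in> N" "u \<in> U"
        "integrable M r" "AE \<omega> in M. f (x \<omega>, u \<omega>) \<omega> \<le> ereal (r \<omega>)" for x z u r
      using le_conj[OF that] real by simp
    have "ereal (pairing M z p + pairing M u y) - \<phi>bar z u \<le> ereal c" if z: "z \<in> X" and u: "u \<in> U" for z u
    proof -
      define s where "s = pairing M z p + pairing M u y"
      \<comment> \<open>With the real numbers on one side the claim is a lower bound for an infimum,
        meaningful also for infinite \<open>\<phi>bar z u\<close>.\<close>
      have "ereal (s - c) \<le> \<phi>bar z u"
        unfolding \<phi>bar_def value_function_def
      proof (rule INF_greatest, elim CollectE conjE)
        fix x assume x: "x \<in> borel_measurable M" and xz: "(\<lambda>\<omega>. x \<omega> - z \<omega>) \<in> N"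
        show "ereal (s - c) \<le> integral_functional M f x u"
        \<comment> \<open>A smaller value, \<open>-\<infinity>\<close> included, would admit a
          majorant with integral below \<open>s - c\<close>, against
          \<open>pairing_minus_integral_le\<close>.\<close>
        proof (rule ccontr)
          assume "\<not> ereal (s - c) \<le> integral_functional M f x u"
          then obtain r where r: "integrable M r" "AE \<omega> in M. f (x \<omega>, u \<omega>) \<omega> \<le> ereal (r \<omega>)"
            and less: "(\<integral>\<omega>. r \<omega> \<partial>M) < s - c"
            using majorant[OF x u] by (auto simp: not_le)
          have "s - (\<integral>\<omega>. r \<omega> \<partial>M) \<le> c"
            unfolding s_def
            by (rule pairing_minus_integral_le[where f=f and F=F and T=T and stage=stage])
              (use assms p y x' u' r' bound x z xz u r in \<open>auto simp: N_def\<close>)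
          with less show False by simp
        qed
      qed
      then show ?thesis
        unfolding s_def[symmetric] by (cases "\<phi>bar z u") auto
    qed
    then show ?thesis
      unfolding real unfolding conjugate_def by (intro SUP_least) auto
  qed
qed

end
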